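(* Let $\mathcal{X}$ be a separable Banach space over $\mathbb{R}$ or $\mathbb{C}$ and let $K \in L(\mathcal{X})$, $K \neq 0$, have closed range. Then the following are equivalent: (i) $\mathcal{X}$ has an approximative $K$-atomic decomposition, i.e. there exist an increasing sequence $\{m_n\}$ of positive integers, a sequence $\{x_n\}\subset\mathcal{X}$, a family $\{h_{n,i}\}_{n\in\mathbb{N},\,1\le i\le m_n}\subset \mathcal{X}^*$ and a BK-space $\mathcal{X}_d$ such that $(\{x_n\},\{h_{n,i}\})$ is an approximative $K$-atomic decomposition for $\mathcal{X}$ with respect to $\mathcal{X}_d$; (ii) there exists a sequence $\{v_i\}_{i\in\mathbb{N}} \subset L(\mathcal{X})$ of finite rank operators such that $K(x)=\sum_{i=1}^{\infty} v_i(x)$ (norm convergence in $\mathcal{X}$) for every $x\in\mathcal{X}$.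
   Context: $L(\mathcal{X})$ is the space of bounded linear operators on $\mathcal{X}$, and $\mathcal{X}^*$ is the dual space. Given an increasing sequence $\{m_n\}_{n\in\mathbb{N}}$ of positive integers, a BK-space $\mathcal{X}_d$ here is a Banach space whose elements are scalar families $\{c_{n,i}\}_{n\in\mathbb{N},\,1\le i\le m_n}$ (with coordinatewise linear operations) and on which every coordinate functional is continuous. Definition. Let $K\in L(\mathcal{X})$, $\{x_n\}\subset\mathcal{X}$, and $\{h_{n,i}\}_{n\in\mathbb{N},\,1\le i\le m_n}\subset\mathcal{X}^*$. The pair $(\{x_n\},\{h_{n,i}\})$ is an approximative $K$-atomic decomposition for $\mathcal{X}$ with respect to $\mathcal{X}_d$ if: (a) $\{h_{n,i}(x)\}_{n\in\mathbb{N},1\le i\le m_n}\in\mathcal{X}_d$ for all $x\in\mathcal{X}$; (b) there are constants $0<A\le B<\infty$ with $A\|K(x)\|_{\mathcal{X}}\le \|\{h_{n,i}(x)\}\|_{\mathcal{X}_d}\le B\|x\|_{\mathcal{X}}$ for all $x\in\mathcal{X}$; (c) for all $x\in\mathcal{X}$ the limit $\lim_{n\to\infty}\sum_{i=1}^{m_n}h_{n,i}(x)x_i$ exists in $\mathcal{X}$ and equals $K(x)$. *)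

theory Defs
  imports "HOL-Analysis.Analysis"
begin

text \<open>
  The scalar field: a normed field with an isometric real-linear ring embedding into the complex
  numbers whose image is the real line or the whole plane, i.e. a copy of the real or of the
  complex numbers.
\<close>

class real_or_complex = real_normed_field +
  assumes real_or_complex:
    "\<exists>f :: 'a \<Rightarrow> complex.
        (\<forall>x y. f (x + y) = f x + f y) \<and>
        (\<forall>x y. f (x * y) = f x * f y) \<and>
        (\<forall>r x. f (r *\<^sub>R x) = r *\<^sub>R f x) \<and>
        (\<forall>x. cmod (f x) = norm x) \<and>
        (range f = \<real> \<or> range f = UNIV)"

instance real :: real_or_complex
  by standard (rule exI[of _ complex_of_real], auto simp: Reals_def scaleR_conv_of_real)

instance complex :: real_or_complex
  by standard (rule exI[of _ id], auto)

text \<open>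
  A Banach space over the scalars \<open>'k\<close>. The type \<open>'a\<close> carries the norm and the
  underlying real structure, with which the multiplication by scalars has to be compatible.
\<close>

locale banach_space_over = vector_space smul
  for smul :: "'k::real_or_complex \<Rightarrow> 'a::banach \<Rightarrow> 'a" +
  assumes smul_of_real: "smul (of_real r) x = r *\<^sub>R x"
    and norm_smul: "norm (smul a x) = norm a * norm x"

lemma banach_space_over_real: "banach_space_over ((*\<^sub>R) :: real \<Rightarrow> 'a::banach \<Rightarrow> 'a)"
  by unfold_locales (auto simp: algebra_simps)

lemma banach_space_over_complex: "banach_space_over ((*) :: complex \<Rightarrow> complex \<Rightarrow> complex)"
  by unfold_locales (auto simp: algebra_simps norm_mult scaleR_conv_of_real)

definition bounded_linear_over ::
    "('k::field \<Rightarrow> 'a::real_normed_vector \<Rightarrow> 'a) \<Rightarrow> ('k \<Rightarrow> 'b::real_normed_vector \<Rightarrow> 'b)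
      \<Rightarrow> ('a \<Rightarrow> 'b) \<Rightarrow> bool"
  where "bounded_linear_over s t T \<longleftrightarrow>
    Vector_Spaces.linear s t T \<and> (\<exists>C. \<forall>x. norm (T x) \<le> C * norm x)"

definition bounded_operators ::
    "('k::field \<Rightarrow> 'a::real_normed_vector \<Rightarrow> 'a) \<Rightarrow> ('a \<Rightarrow> 'a) set"
  where "bounded_operators smul = {T. bounded_linear_over smul smul T}"

definition dual_space ::
    "('k::real_normed_field \<Rightarrow> 'a::real_normed_vector \<Rightarrow> 'a) \<Rightarrow> ('a \<Rightarrow> 'k) set"
  where "dual_space smul = {f. bounded_linear_over smul (*) f}"

definition finite_rank :: "('k::field \<Rightarrow> 'a::ab_group_add \<Rightarrow> 'a) \<Rightarrow> ('a \<Rightarrow> 'a) \<Rightarrow> bool"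
  where "finite_rank smul T \<longleftrightarrow> (\<exists>S. finite S \<and> range T = module.span smul S)"

text \<open>
  A family \<open>(c n i)\<close>, indexed by \<open>n\<close> and \<open>1 \<le> i \<le> m n\<close>, is represented by the function
  \<open>c :: nat \<Rightarrow> nat \<Rightarrow> 'k\<close> that is \<open>0\<close> outside the index set.
\<close>

definition families :: "(nat \<Rightarrow> nat) \<Rightarrow> (nat \<Rightarrow> nat \<Rightarrow> 'k::zero) set"
  where "families m = {c. \<forall>n i. i \<notin> {1..m n} \<longrightarrow> c n i = 0}"

definition restrict_family :: "(nat \<Rightarrow> nat) \<Rightarrow> (nat \<Rightarrow> nat \<Rightarrow> 'k::zero) \<Rightarrow> nat \<Rightarrow> nat \<Rightarrow> 'k"
  where "restrict_family m c = (\<lambda>n i. if i \<in> {1..m n} then c n i else 0)"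

text \<open>
  The values of \<open>N\<close> outside \<open>X\<close> are irrelevant; the distance is set to \<open>0\<close> there because the
  locale \<open>Metric_space\<close> asks for nonnegativity and symmetry on the whole type.
\<close>

definition norm_dist ::
    "(nat \<Rightarrow> nat \<Rightarrow> 'k::minus) set \<Rightarrow> ((nat \<Rightarrow> nat \<Rightarrow> 'k) \<Rightarrow> real)
      \<Rightarrow> (nat \<Rightarrow> nat \<Rightarrow> 'k) \<Rightarrow> (nat \<Rightarrow> nat \<Rightarrow> 'k) \<Rightarrow> real"
  where "norm_dist X N c d = (if c \<in> X \<and> d \<in> X then N (\<lambda>n i. c n i - d n i) else 0)"

definition BK_space ::
    "(nat \<Rightarrow> nat) \<Rightarrow> (nat \<Rightarrow> nat \<Rightarrow> 'k::real_normed_field) set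
      \<Rightarrow> ((nat \<Rightarrow> nat \<Rightarrow> 'k) \<Rightarrow> real) \<Rightarrow> bool"
  where "BK_space m X N \<longleftrightarrow>
    X \<subseteq> families m \<and>
    (\<lambda>n i. 0) \<in> X \<and>
    (\<forall>c\<in>X. \<forall>d\<in>X. (\<lambda>n i. c n i + d n i) \<in> X) \<and>
    (\<forall>a. \<forall>c\<in>X. (\<lambda>n i. a * c n i) \<in> X) \<and>
    (\<forall>c\<in>X. 0 \<le> N c) \<and>
    (\<forall>c\<in>X. N c = 0 \<longleftrightarrow> c = (\<lambda>n i. 0)) \<and>
    (\<forall>a. \<forall>c\<in>X. N (\<lambda>n i. a * c n i) = norm a * N c) \<and>
    (\<forall>c\<in>X. \<forall>d\<in>X. N (\<lambda>n i. c n i + d n i) \<le> N c + N d) \<and>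
    Metric_space.mcomplete X (norm_dist X N) \<and>
    (\<forall>n. \<forall>i\<in>{1..m n}.
      continuous_map (Metric_space.mtopology X (norm_dist X N)) euclidean (\<lambda>c. c n i))"

lemma BK_space_Metric_space:
  assumes "BK_space m X N"
  shows "Metric_space X (norm_dist X N)"
proof -
  have add: "(\<lambda>n i. c n i + d n i) \<in> X" and tri: "N (\<lambda>n i. c n i + d n i) \<le> N c + N d"
    if "c \<in> X" "d \<in> X" for c d
    using assms that by (auto simp: BK_space_def)
  have mul: "(\<lambda>n i. a * c n i) \<in> X" and hom: "N (\<lambda>n i. a * c n i) = norm a * N c"
    and nonneg: "0 \<le> N c" and zero: "N c = 0 \<longleftrightarrow> c = (\<lambda>n i. 0)"
    if "c \<in> X" for a c
    using assms that by (auto simp: BK_space_def)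
  have sub: "(\<lambda>n i. c n i - d n i) \<in> X" if "c \<in> X" "d \<in> X" for c d
    using add[OF that(1) mul[OF that(2), of "-1"]] by simp
  show ?thesis
  proof
    fix c d
    show "0 \<le> norm_dist X N c d"
      by (simp add: norm_dist_def nonneg sub)
    show "norm_dist X N c d = norm_dist X N d c"
      using hom[OF sub[of c d], of "-1"] by (auto simp: norm_dist_def)
  next
    fix c d assume "c \<in> X" "d \<in> X"
    then show "norm_dist X N c d = 0 \<longleftrightarrow> c = d"
      by (auto simp: norm_dist_def zero sub fun_eq_iff)
  next
    fix c d e assume "c \<in> X" "d \<in> X" "e \<in> X"
    then show "norm_dist X N c e \<le> norm_dist X N c d + norm_dist X N d e"
      using tri[OF sub[of c d] sub[of d e]] by (simp add: norm_dist_def)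
  qed
qed

text \<open>
  The vectors are \<open>x 1, x 2, \<dots>\<close> (the entry \<open>x 0\<close> is never used), and \<open>h n i\<close> matters
  only for \<open>1 \<le> i \<le> m n\<close>.
\<close>

definition approx_K_atomic_decomposition ::
    "('k::real_normed_field \<Rightarrow> 'a::real_normed_vector \<Rightarrow> 'a) \<Rightarrow> ('a \<Rightarrow> 'a) \<Rightarrow> (nat \<Rightarrow> nat)
      \<Rightarrow> (nat \<Rightarrow> 'a) \<Rightarrow> (nat \<Rightarrow> nat \<Rightarrow> 'a \<Rightarrow> 'k)
      \<Rightarrow> (nat \<Rightarrow> nat \<Rightarrow> 'k) set \<Rightarrow> ((nat \<Rightarrow> nat \<Rightarrow> 'k) \<Rightarrow> real) \<Rightarrow> bool"
  where "approx_K_atomic_decomposition smul K m x h X N \<longleftrightarrow>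
    (\<forall>y. restrict_family m (\<lambda>n i. h n i y) \<in> X) \<and>
    (\<exists>A B. 0 < A \<and> A \<le> B \<and>
      (\<forall>y. A * norm (K y) \<le> N (restrict_family m (\<lambda>n i. h n i y)) \<and>
           N (restrict_family m (\<lambda>n i. h n i y)) \<le> B * norm y)) \<and>
    (\<forall>y. (\<lambda>n. \<Sum>i = 1..m n. smul (h n i y) (x i)) \<longlonglongrightarrow> K y)"

end

theory Submission
  imports Defs
begin

text \<open>
  Both conditions say that \<open>K\<close> is a pointwise limit of bounded finite rank operators. From a
  decomposition one reads off the operators \<open>S n y = (\<Sum>i = 1..m n. smul (h n i y) (x i))\<close>, and
  their consecutive differences are the terms of a series with sum \<open>K\<close>
  (\<open>finite_rank_series_if_finite_expansions_converge\<close>).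

  Conversely, let \<open>K\<close> be the sum of a series of bounded finite rank operators. Two things have to
  be produced.

  First, functionals and vectors. In a basis of its range, a bounded finite rank operator is a
  finite sum of terms \<open>smul (f y) e\<close>, in which the coefficient functionals \<open>f\<close> are bounded because
  coordinates in a finite-dimensional subspace are bounded by the norm (\<open>coefficients_bounded\<close>,
  \<open>finite_rank_expansion\<close>). Stringing these expansions together turns the partial sums of the series
  into expansions in a single sequence of vectors (\<open>finite_expansions_if_finite_rank_series\<close>).

  Second, the BK-space. Let \<open>H y\<close> be the coefficient family of \<open>y\<close>. The range of \<open>H\<close> with the
  quotient norm carried over from the Banach space modulo the kernel of \<open>H\<close> is a BK-space
  (\<open>BK_space_quotient_norm\<close>). In this norm \<open>H\<close> is a contraction, which is the upper bound. For the
  lower bound, \<open>K y\<close> is a limit of expressions in the coefficients of \<open>y\<close> alone, so \<open>K\<close> factors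
  through \<open>H\<close>, and a bounded operator that factors through a quotient map is bounded with respect
  to the quotient norm (\<open>approx_K_atomic_decomposition_quotient_norm\<close>).
\<close>

section \<open>Coordinates in finite-dimensional subspaces\<close>

text \<open>
  The isometric copy of the scalars in the complex plane is closed, so completeness is inherited.
\<close>

lemma Cauchy_imp_convergent_scalars:
  fixes a :: "nat \<Rightarrow> 'k::real_or_complex"
  assumes "Cauchy a"
  shows "convergent a"
proof -
  obtain f :: "'k \<Rightarrow> complex" where add: "\<And>x y. f (x + y) = f x + f y"
    and isometry: "\<And>x. cmod (f x) = norm x" and range: "range f = \<real> \<or> range f = UNIV"
    using real_or_complex[where 'a = 'k] by metis
  have diff: "f (x - y) = f x - f y" for x y
    using add[of "x - y" y] by (simp add: algebra_simps)
  have "Cauchy (\<lambda>n. f (a n))"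
    using assms by (simp add: Cauchy_def dist_norm isometry flip: diff)
  then obtain z where z: "(\<lambda>n. f (a n)) \<longlonglongrightarrow> z"
    using Cauchy_convergent_iff convergent_def by blast
  have "closed (range f)"
    using range closed_complex_Reals by auto
  then have "z \<in> range f"
    using z closed_sequentially[of "range f" "\<lambda>n. f (a n)" z] by blast
  then obtain l where "z = f l"
    by blast
  then have "(\<lambda>n. cmod (f (a n - l))) \<longlonglongrightarrow> 0"
    using z by (simp add: diff LIM_zero tendsto_norm_zero)
  then have "(\<lambda>n. a n - l) \<longlonglongrightarrow> 0"
    by (simp add: isometry tendsto_norm_zero_iff)
  then show ?thesis
    using LIM_zero_cancel convergent_def by blast
qed

context banach_space_over
begin

lemma tendsto_smul:
  assumes "a \<longlonglongrightarrow> l"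
  shows "(\<lambda>n. smul (a n) b) \<longlonglongrightarrow> smul l b"
proof -
  have "(\<lambda>n. norm (a n - l) * norm b) \<longlonglongrightarrow> 0"
    using tendsto_mult_left_zero[OF tendsto_norm_zero[OF LIM_zero[OF assms]]] .
  then have "(\<lambda>n. norm (smul (a n) b - smul l b)) \<longlonglongrightarrow> 0"
    by (simp add: norm_smul flip: scale_left_diff_distrib)
  then show ?thesis
    by (simp add: LIM_zero_cancel tendsto_norm_zero_iff)
qed

text \<open>
  If coordinates are bounded by the norm, the coordinates of a convergent sequence are Cauchy, and
  their limits are the coordinates of the limit. This closedness of the span drives the induction
  step of the next lemma.
\<close>

lemma limit_in_span_if_coefficients_bounded:
  assumes fin: "finite B"
    and bound: "\<And>a b. b \<in> B \<Longrightarrow> norm (a b) \<le> C * norm (\<Sum>b\<in>B. smul (a b) b)"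
    and y: "\<And>n. y n \<in> span B" and lim: "y \<longlonglongrightarrow> e"
  shows "e \<in> span B"
proof -
  have "\<exists>a. y n = (\<Sum>b\<in>B. smul (a b) b)" for n
    using y[of n] by (auto simp: span_finite[OF fin])
  then obtain a where a: "\<And>n. y n = (\<Sum>b\<in>B. smul (a n b) b)"
    by metis
  have "convergent (\<lambda>n. a n b)" if "b \<in> B" for b
  proof -
    have diff: "norm (a n b - a k b) \<le> \<bar>C\<bar> * norm (y n - y k)" for n k
    proof -
      have "norm (a n b - a k b) \<le> C * norm (y n - y k)"
        using bound[OF that, of "\<lambda>b. a n b - a k b"]
        by (simp add: a scale_left_diff_distrib sum_subtractf)
      also have "\<dots> \<le> \<bar>C\<bar> * norm (y n - y k)"
        by (simp add: mult_right_mono)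
      finally show ?thesis .
    qed
    have "Cauchy (\<lambda>n. a n b)"
    proof (rule CauchyI)
      fix r :: real
      assume "0 < r"
      then have "0 < r / (\<bar>C\<bar> + 1)"
        by simp
      from CauchyD[OF LIMSEQ_imp_Cauchy[OF lim] this]
      obtain M where M: "\<And>n k. n \<ge> M \<Longrightarrow> k \<ge> M \<Longrightarrow> norm (y n - y k) < r / (\<bar>C\<bar> + 1)"
        by blast
      have "norm (a n b - a k b) < r" if "n \<ge> M" "k \<ge> M" for n k
      proof -
        have "norm (a n b - a k b) \<le> (\<bar>C\<bar> + 1) * norm (y n - y k)"
          using diff[of n k] by (simp add: distrib_right add_increasing2)
        also have "\<dots> < r"
          using M[OF that] by (simp add: pos_less_divide_eq mult.commute add_nonneg_pos)
        finally show ?thesis .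
      qed
      then show "\<exists>M. \<forall>n\<ge>M. \<forall>k\<ge>M. norm (a n b - a k b) < r"
        by blast
    qed
    then show ?thesis
      by (rule Cauchy_imp_convergent_scalars)
  qed
  then obtain l where l: "\<And>b. b \<in> B \<Longrightarrow> (\<lambda>n. a n b) \<longlonglongrightarrow> l b"
    unfolding convergent_def by metis
  then have "y \<longlonglongrightarrow> (\<Sum>b\<in>B. smul (l b) b)"
    unfolding a[abs_def] by (intro tendsto_sum tendsto_smul)
  then have "e = (\<Sum>b\<in>B. smul (l b) b)"
    using lim LIMSEQ_unique by blast
  then show ?thesis
    by (simp add: span_sum span_scale span_base)
qed

text \<open>
  Induction on the basis. The span of \<open>B\<close> is closed by the induction hypothesis, so a new basis
  vector \<open>e\<close> has positive distance \<open>d\<close> from it. Hence a vector \<open>smul \<alpha> e + y\<close> with \<open>y\<close> in that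
  span has norm at least \<open>norm \<alpha> * d\<close>; this bounds the new coordinate, then \<open>y\<close>, and then the old
  coordinates.
\<close>

lemma coefficients_bounded:
  assumes "finite B" "independent B"
  shows "\<exists>C. \<forall>a. \<forall>b\<in>B. norm (a b) \<le> C * norm (\<Sum>b\<in>B. smul (a b) b)"
  using assms
proof (induction B rule: finite_induct)
  case empty
  then show ?case
    by simp
next
  case (insert e B)
  then have e: "e \<notin> span B" and indep: "independent B"
    by (auto simp: independent_insert)
  then obtain C where C: "\<And>a b. b \<in> B \<Longrightarrow> norm (a b) \<le> C * norm (\<Sum>b\<in>B. smul (a b) b)"
    using insert.IH by blast
  have "\<exists>d>0. \<forall>y\<in>span B. d \<le> norm (e - y)"
  proof (rule ccontr)
    assume "\<not> ?thesis"
    then have "\<forall>n. \<exists>y\<in>span B. norm (e - y) < inverse (real (Suc n))"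
      by (metis inverse_positive_iff_positive not_le of_nat_0_less_iff zero_less_Suc)
    then obtain y where y: "\<And>n. y n \<in> span B"
      and close: "\<And>n. norm (e - y n) < inverse (real (Suc n))"
      by metis
    have "(\<lambda>n. y n - e) \<longlonglongrightarrow> 0"
      by (rule LIMSEQ_norm_0) (use close in \<open>simp add: norm_minus_commute divide_inverse\<close>)
    then have "y \<longlonglongrightarrow> e"
      by (rule LIM_zero_cancel)
    with \<open>finite B\<close> C y have "e \<in> span B"
      by (rule limit_in_span_if_coefficients_bounded)
    with e show False ..
  qed
  then obtain d where "d > 0" and d: "\<And>y. y \<in> span B \<Longrightarrow> d \<le> norm (e - y)"
    by blast
  define D where "D = \<bar>C\<bar> * (1 + norm e / d)"
  have "norm (a b) \<le> (1 / d + D) * norm (\<Sum>b\<in>insert e B. smul (a b) b)" (is "_ \<le> _ * norm ?w")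
    if b: "b \<in> insert e B" for a b
  proof -
    define y where "y = (\<Sum>b\<in>B. smul (a b) b)"
    have y: "y \<in> span B"
      by (simp add: y_def span_sum span_scale span_base)
    have w: "?w = smul (a e) e + y"
      using insert.hyps by (simp add: y_def)
    have ae: "norm (a e) \<le> norm ?w / d"
    proof (cases "a e = 0")
      case False
      \<comment> \<open>Dividing by \<open>a e\<close> exhibits the norm of the combination as a multiple of a distance from \<open>e\<close>
        to the span.\<close>
      then have "smul (a e) (e - smul (- inverse (a e)) y) = ?w"
        unfolding w by (simp add: scale_right_distrib)
      then have "norm (a e) * norm (e - smul (- inverse (a e)) y) = norm ?w"
        using norm_smul by metis
      moreover have "norm (a e) * d \<le> norm (a e) * norm (e - smul (- inverse (a e)) y)"
        using y by (intro mult_left_mono d span_scale) auto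
      ultimately show ?thesis
        using \<open>d > 0\<close> by (simp add: pos_le_divide_eq)
    qed (use \<open>d > 0\<close> in simp)
    have "norm y \<le> norm ?w + norm (a e) * norm e"
      using norm_triangle_ineq4[of ?w "smul (a e) e"] w by (simp add: norm_smul)
    also have "\<dots> \<le> norm ?w + norm ?w / d * norm e"
      by (rule add_left_mono[OF mult_right_mono[OF ae norm_ge_zero]])
    finally have "norm y \<le> (1 + norm e / d) * norm ?w"
      by (simp add: algebra_simps)
    then have yD: "\<bar>C\<bar> * norm y \<le> D * norm ?w"
      unfolding D_def by (metis abs_ge_zero mult.assoc mult_left_mono)
    have D: "0 \<le> D * norm ?w" and d0: "0 \<le> norm ?w / d"
      using \<open>d > 0\<close> by (simp_all add: D_def)
    show ?thesis
    proof (cases "b = e")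
      case True
      then show ?thesis
        using ae D by (simp add: distrib_right)
    next
      case False
      then have "norm (a b) \<le> C * norm y"
        using b C unfolding y_def by blast
      also have "\<dots> \<le> \<bar>C\<bar> * norm y"
        by (simp add: mult_right_mono)
      finally show ?thesis
        using yD d0 by (simp add: distrib_right)
    qed
  qed
  then show ?case
    by blast
qed

section \<open>Operators of finite rank\<close>

lemma vector_space_scalars: "vector_space ((*) :: 'k \<Rightarrow> 'k \<Rightarrow> 'k)"
  by unfold_locales (auto simp: algebra_simps)

lemma dual_space_iff:
  "f \<in> dual_space smul \<longleftrightarrow>
    (\<forall>x y. f (x + y) = f x + f y) \<and> (\<forall>c x. f (smul c x) = c * f x) \<and> (\<exists>C. \<forall>x. norm (f x) \<le> C * norm x)"
  by (auto simp: dual_space_def bounded_linear_over_def Vector_Spaces.linear_iff vector_space_scalars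
      vector_space_axioms)

lemma bounded_operators_iff:
  "T \<in> bounded_operators smul \<longleftrightarrow>
    (\<forall>x y. T (x + y) = T x + T y) \<and> (\<forall>c x. T (smul c x) = smul c (T x)) \<and>
    (\<exists>C. \<forall>x. norm (T x) \<le> C * norm x)"
  by (auto simp: bounded_operators_def bounded_linear_over_def Vector_Spaces.linear_iff vector_space_axioms)

lemma dual_space_zero: "(\<lambda>_. 0) \<in> dual_space smul"
  by (auto simp: dual_space_iff intro: exI[of _ 0])

text \<open>
  The definition of finite rank asks for a finite set that spans exactly the range; a basis of the
  range is finite by the exchange lemma.
\<close>

lemma finite_rank_if_range_subset:
  assumes "T \<in> bounded_operators smul" "finite S" "range T \<subseteq> span S"
  shows "finite_rank smul T"
proof -
  have sub: "subspace (range T)"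
    using assms(1) unfolding bounded_operators_iff subspace_def
    by (auto simp: image_iff) (metis scale_zero_left, metis, metis)
  obtain B where B: "B \<subseteq> range T" "independent B" "range T \<subseteq> span B"
    using maximal_independent_subset by blast
  have "finite B"
    using independent_span_bound[OF \<open>finite S\<close> B(2)] B(1) assms(3) by blast
  moreover have "range T = span B"
    using B span_minimal[OF B(1) sub] by blast
  ultimately show ?thesis
    unfolding finite_rank_def by blast
qed

text \<open>
  The functionals are the coordinates of \<open>T x\<close> in a basis of the range. The terms form a list, so
  that the expansions of several operators can be concatenated.
\<close>

lemma finite_rank_expansion:
  assumes "T \<in> bounded_operators smul" "finite_rank smul T"
  shows "\<exists>M. M \<noteq> [] \<and> fst ` set M \<subseteq> dual_space smul \<and> (\<forall>x. T x = (\<Sum>(f, e)\<leftarrow>M. smul (f x) e))"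
proof -
  obtain S where S: "finite S" "range T = span S"
    using assms(2) finite_rank_def by blast
  obtain B where B: "B \<subseteq> S" "independent B" "S \<subseteq> span B"
    using maximal_independent_subset by blast
  have fin: "finite B"
    using B(1) S(1) finite_subset by blast
  have T: "T x \<in> span B" for x
    using S(2) span_minimal[OF B(3) subspace_span] by blast
  obtain C where C: "\<And>a b. b \<in> B \<Longrightarrow> norm (a b) \<le> C * norm (\<Sum>b\<in>B. smul (a b) b)"
    using coefficients_bounded[OF fin B(2)] by blast
  obtain C' where C': "\<And>x. norm (T x) \<le> C' * norm x"
    using assms(1) bounded_operators_iff by blast
  define f where "f b x = representation B (T x) b" for b x
  have expand: "T x = (\<Sum>b\<in>B. smul (f b x) b)" for x
    unfolding f_def by (simp add: sum_representation_eq[OF B(2) T fin])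
  have dual: "f b \<in> dual_space smul" if "b \<in> B" for b
    unfolding dual_space_iff
  proof (intro conjI allI)
    show "f b (x + y) = f b x + f b y" for x y
      using assms(1) by (simp add: f_def bounded_operators_iff representation_add[OF B(2) T T])
    show "f b (smul c x) = c * f b x" for c x
      using assms(1) by (simp add: f_def bounded_operators_iff representation_scale[OF B(2) T])
    have "norm (f b x) \<le> (\<bar>C\<bar> * C') * norm x" for x
    proof -
      have "norm (f b x) \<le> C * norm (T x)"
        unfolding expand using C[OF that, of "\<lambda>b. f b x"] .
      also have "\<dots> \<le> \<bar>C\<bar> * norm (T x)"
        by (simp add: mult_right_mono)
      also have "\<dots> \<le> \<bar>C\<bar> * (C' * norm x)"
        by (simp add: C' mult_left_mono)
      finally show ?thesis
        by (simp add: mult.assoc)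
    qed
    then show "\<exists>C. \<forall>x. norm (f b x) \<le> C * norm x"
      by blast
  qed
  obtain L where L: "distinct L" "set L = B"
    using finite_distinct_list[OF fin] by blast
  \<comment> \<open>The vanishing first term makes the list nonempty, even if \<open>T\<close> is zero.\<close>
  define M where "M = (\<lambda>_. 0, 0) # map (\<lambda>b. (f b, b)) L"
  have "fst ` set M \<subseteq> dual_space smul"
    using dual L(2) dual_space_zero by (auto simp: M_def)
  moreover have "T x = (\<Sum>(f, e)\<leftarrow>M. smul (f x) e)" for x
    using L by (simp add: M_def expand o_def sum_list_distinct_conv_sum_set)
  moreover have "M \<noteq> []"
    by (simp add: M_def)
  ultimately show ?thesis
    by blast
qed

lemma bounded_operators_rank_one:
  assumes "f \<in> dual_space smul"
  shows "(\<lambda>y. smul (f y) e) \<in> bounded_operators smul"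
proof -
  obtain C where C: "\<And>y. norm (f y) \<le> C * norm y"
    using assms dual_space_iff by blast
  have "norm (smul (f y) e) \<le> (C * norm e) * norm y" for y
    using mult_right_mono[OF C norm_ge_zero, of y e] by (simp add: norm_smul mult_ac)
  then show ?thesis
    using assms unfolding bounded_operators_iff dual_space_iff by (auto simp: scale_left_distrib)
qed

lemma bounded_operators_zero: "(\<lambda>_. 0) \<in> bounded_operators smul"
  by (auto simp: bounded_operators_iff intro: exI[of _ 0])

lemma bounded_operators_add:
  assumes "S \<in> bounded_operators smul" "T \<in> bounded_operators smul"
  shows "(\<lambda>y. S y + T y) \<in> bounded_operators smul"
proof -
  obtain C D where "\<And>y. norm (S y) \<le> C * norm y" "\<And>y. norm (T y) \<le> D * norm y"
    using assms bounded_operators_iff by meson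
  then have "norm (S y + T y) \<le> (C + D) * norm y" for y
    by (simp add: norm_triangle_mono distrib_right)
  then show ?thesis
    using assms unfolding bounded_operators_iff by (auto simp: scale_right_distrib)
qed

lemma bounded_operators_uminus:
  assumes "T \<in> bounded_operators smul"
  shows "(\<lambda>y. - T y) \<in> bounded_operators smul"
  using assms by (simp add: bounded_operators_iff)

lemma bounded_operators_finite_expansion:
  assumes "\<And>i. i \<in> I \<Longrightarrow> f i \<in> dual_space smul"
  shows "(\<lambda>y. \<Sum>i\<in>I. smul (f i y) (x i)) \<in> bounded_operators smul"
  using assms
  by (induction I rule: infinite_finite_induct)
    (simp_all add: bounded_operators_zero bounded_operators_add bounded_operators_rank_one)

section \<open>Series of finite rank operators and convergent finite expansions\<close>

lemma finite_rank_series_if_finite_expansions_converge: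
  fixes m :: "nat \<Rightarrow> nat"
  assumes dual: "\<And>n i. i \<in> {1..m n} \<Longrightarrow> h n i \<in> dual_space smul"
    and lim: "\<And>y. (\<lambda>n. \<Sum>i = 1..m n. smul (h n i y) (x i)) \<longlonglongrightarrow> K y"
  shows "\<exists>v. (\<forall>n. v n \<in> bounded_operators smul \<and> finite_rank smul (v n)) \<and> (\<forall>y. (\<lambda>n. v n y) sums K y)"
proof -
  define S where "S n y = (\<Sum>i = 1..m n. smul (h n i y) (x i))" for n y
  define v where "v n y = S n y - (if n = 0 then 0 else S (n - 1) y)" for n y
  have S: "S n \<in> bounded_operators smul" for n
    unfolding S_def[abs_def] using dual by (rule bounded_operators_finite_expansion)
  have v: "v n \<in> bounded_operators smul" for n
    using bounded_operators_add[OF S[of n] bounded_operators_uminus[OF S[of "n - 1"]]] S[of n]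
    by (cases "n = 0") (simp_all add: v_def[abs_def])
  have S_span: "S n y \<in> span (x ` {1..m n})" for n y
    unfolding S_def by (intro span_sum span_scale span_base) auto
  have span: "S n y \<in> span (x ` ({1..m n} \<union> {1..m (n - 1)}))"
    "S (n - 1) y \<in> span (x ` ({1..m n} \<union> {1..m (n - 1)}))" for n y
    by (rule subsetD[OF span_mono S_span]; blast)+
  have "v n y \<in> span (x ` ({1..m n} \<union> {1..m (n - 1)}))" for n y
    unfolding v_def using span(1)[of n y] span_diff[OF span(1)[of n y] span(2)[of n y]]
    by (cases "n = 0") simp_all
  then have "finite_rank smul (v n)" for n
    by (intro finite_rank_if_range_subset[OF v, of "x ` ({1..m n} \<union> {1..m (n - 1)})"]) auto
  moreover have "(\<Sum>i\<le>n. v i y) = S n y" for n y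
    by (induction n) (simp_all add: v_def)
  then have "(\<lambda>n. v n y) sums K y" for y
    using lim[of y] by (simp add: sums_def_le S_def)
  ultimately show ?thesis
    using v by (intro exI[of _ v]) simp
qed

text \<open>
  The terms of \<open>v 0, \<dots>, v n\<close> are concatenated to a list \<open>L n\<close>. Since \<open>L n\<close> is a prefix of
  \<open>L (Suc n)\<close>, the vector at a given position does not depend on \<open>n\<close>, so all partial sums are
  expansions in one sequence. As every operator contributes at least one term, the lengths \<open>m n\<close>
  increase strictly.
\<close>

lemma finite_expansions_if_finite_rank_series:
  fixes v :: "nat \<Rightarrow> 'a \<Rightarrow> 'a"
  assumes v: "\<And>n. v n \<in> bounded_operators smul" "\<And>n. finite_rank smul (v n)"
  obtains m :: "nat \<Rightarrow> nat" and h :: "nat \<Rightarrow> nat \<Rightarrow> 'a \<Rightarrow> 'k" and x :: "nat \<Rightarrow> 'a"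
  where "strict_mono m" "\<And>n. 0 < m n" "\<And>n i. i \<in> {1..m n} \<Longrightarrow> h n i \<in> dual_space smul"
    and "\<And>n y. (\<Sum>i = 1..m n. smul (h n i y) (x i)) = (\<Sum>k\<le>n. v k y)"
proof -
  obtain M where nonempty: "\<And>n. M n \<noteq> []" and dual: "\<And>n. fst ` set (M n) \<subseteq> dual_space smul"
    and M: "\<And>n y. v n y = (\<Sum>(f, e)\<leftarrow>M n. smul (f y) e)"
    using finite_rank_expansion[OF v] by metis
  define L where "L n = concat (map M [0..<Suc n])" for n
  define m where "m n = length (L n)" for n
  \<comment> \<open>Positions are counted from 1. The list \<open>L i\<close> has more than \<open>i\<close> entries, so it contains
    position \<open>i\<close>.\<close>
  define x where "x i = snd (L i ! (i - 1))" for i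
  define h where "h n i = fst (L n ! (i - 1))" for n i
  have L_Suc: "L (Suc n) = L n @ M (Suc n)" for n
    by (simp add: L_def)
  have "m n < m (Suc n)" for n
    using nonempty[of "Suc n"] by (simp add: m_def L_Suc)
  then have m: "strict_mono m"
    by (simp add: strict_mono_Suc_iff)
  have "0 < m 0"
    using nonempty[of 0] by (simp add: m_def L_def)
  then have m_pos: "0 < m n" for n
    using strict_mono_less_eq[OF m, of 0 n] by simp
  have m_ge: "n < m n" for n
  proof (induction n)
    case (Suc n)
    then show ?case
      using strict_monoD[OF m, of n "Suc n"] by simp
  qed (rule m_pos)
  have prefix: "L n ! j = L k ! j" if "k \<le> n" "j < m k" for k n j
    using that(1)
  proof (induction n rule: dec_induct)
    case (step n)
    have "j < m n"
      using that(2) strict_mono_less_eq[OF m, of k n] step.hyps by simp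
    with step.IH show ?case
      by (simp add: L_Suc nth_append m_def)
  qed simp
  have snd_L: "snd (L n ! j) = x (Suc j)" if "j < m n" for n j
    using prefix[of n "Suc j" j] prefix[of "Suc j" n j] that m_ge[of "Suc j"]
    by (cases "n \<le> Suc j") (simp_all add: x_def)
  have "(\<Sum>i = 1..m n. smul (h n i y) (x i)) = (\<Sum>(f, e)\<leftarrow>L n. smul (f y) e)" for n y
  proof -
    have "(\<Sum>i = 1..m n. smul (h n i y) (x i)) = (\<Sum>j<m n. smul (fst (L n ! j) y) (snd (L n ! j)))"
      using sum.atLeast1_atMost_eq[of "\<lambda>i. smul (h n i y) (x i)" "m n"] by (simp add: snd_L h_def)
    then show ?thesis
      by (simp add: sum_list_sum_nth m_def case_prod_unfold lessThan_atLeast0)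
  qed
  moreover have "(\<Sum>(f, e)\<leftarrow>L n. smul (f y) e) = (\<Sum>k\<le>n. v k y)" for n y
    by (induction n) (simp_all add: L_Suc M, simp add: L_def)
  moreover have "h n i \<in> dual_space smul" if "i \<in> {1..m n}" for n i
  proof -
    have "L n ! (i - 1) \<in> set (L n)"
      using that by (intro nth_mem) (auto simp: m_def)
    then show ?thesis
      using dual by (auto simp: h_def L_def image_subset_iff)
  qed
  ultimately show ?thesis
    using that[OF m m_pos, of h x] by simp
qed

end

section \<open>The quotient norm on a space of families\<close>

text \<open>
  For linear \<open>H\<close>, this is the norm on the range of \<open>H\<close> that makes it isometric to the domain modulo
  the kernel of \<open>H\<close>. Off the range the infimum is over the empty set and has no meaning.
\<close>

definition quotient_norm :: "('a::real_normed_vector \<Rightarrow> 'b) \<Rightarrow> 'b \<Rightarrow> real"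
  where "quotient_norm H c = (INF x\<in>{x. H x = c}. norm x)"

lemma bdd_below_norm_image: "bdd_below (norm ` A)"
  by (rule bdd_belowI[of _ 0]) auto

lemma quotient_norm_le: "quotient_norm H (H x) \<le> norm x"
  unfolding quotient_norm_def by (rule cINF_lower[OF bdd_below_norm_image]) simp

lemma quotient_norm_greatest:
  assumes "\<And>y. H y = H x \<Longrightarrow> r \<le> norm y"
  shows "r \<le> quotient_norm H (H x)"
  unfolding quotient_norm_def using assms by (intro cINF_greatest) auto

lemma quotient_norm_lessD:
  assumes "quotient_norm H (H x) < r"
  shows "\<exists>y. H y = H x \<and> norm y < r"
  using assms quotient_norm_greatest[of H x r] by (meson not_le)

lemma quotient_norm_nonneg: "0 \<le> quotient_norm H (H x)"
  by (simp add: quotient_norm_greatest)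

context banach_space_over
begin

text \<open>
  The range is complete because a quotient of a Banach space is: differences along a fast
  subsequence of a Cauchy sequence lift to an absolutely convergent series in the domain. A bounded
  functional \<open>\<lambda>x. H x n i\<close> takes the same value on all preimages of a family, so its bound passes
  to the infimum of their norms, and the coordinates are continuous.
\<close>

lemma BK_space_quotient_norm:
  fixes H :: "'a \<Rightarrow> nat \<Rightarrow> nat \<Rightarrow> 'k"
  assumes dual: "\<And>n i. (\<lambda>x. H x n i) \<in> dual_space smul" and families: "range H \<subseteq> families m"
  shows "BK_space m (range H) (quotient_norm H)"
proof -
  let ?N = "quotient_norm H"
  let ?d = "norm_dist (range H) ?N"
  have add: "H (x + y) = (\<lambda>n i. H x n i + H y n i)" for x y
    using dual unfolding dual_space_iff by (intro ext) blast
  have scale: "H (smul a x) = (\<lambda>n i. a * H x n i)" for a x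
    using dual unfolding dual_space_iff by (intro ext) blast
  have diff: "H (x - y) = (\<lambda>n i. H x n i - H y n i)" for x y
    using add[of "x - y" y] by (simp add: fun_eq_iff)
  have H_zero: "H 0 = (\<lambda>n i. 0)"
    using diff[of 0 0] by simp
  have coordinate: "\<exists>C>0. \<forall>x. norm (H x n i) \<le> C * ?N (H x)" for n i
  proof -
    obtain C where C: "\<And>x. norm (H x n i) \<le> C * norm x"
      using dual[of n i] unfolding dual_space_iff by blast
    have "norm (H x n i) / (\<bar>C\<bar> + 1) \<le> ?N (H x)" for x
    proof (rule quotient_norm_greatest)
      fix y
      assume "H y = H x"
      then have "norm (H x n i) \<le> C * norm y"
        using C[of y] by simp
      also have "\<dots> \<le> (\<bar>C\<bar> + 1) * norm y"
        by (intro mult_right_mono) auto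
      finally show "norm (H x n i) / (\<bar>C\<bar> + 1) \<le> norm y"
        by (simp add: pos_divide_le_eq add_nonneg_pos mult.commute)
    qed
    then show ?thesis
      by (intro exI[of _ "\<bar>C\<bar> + 1"]) (simp add: pos_divide_le_eq add_nonneg_pos mult.commute)
  qed
  have N_zero: "?N (H x) = 0 \<longleftrightarrow> H x = (\<lambda>n i. 0)" for x
  proof
    assume "?N (H x) = 0"
    then show "H x = (\<lambda>n i. 0)"
      by (intro ext) (metis coordinate mult_zero_right norm_le_zero_iff)
  next
    assume "H x = (\<lambda>n i. 0)"
    then have "?N (H x) \<le> 0"
      using quotient_norm_le[of H 0] H_zero by simp
    then show "?N (H x) = 0"
      using quotient_norm_nonneg[of H x] by simp
  qed
  have N_add: "?N (H (x + y)) \<le> ?N (H x) + ?N (H y)" for x y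
  proof (rule field_le_epsilon)
    fix e :: real
    assume "0 < e"
    obtain x' y' where "H x' = H x" "norm x' < ?N (H x) + e / 2"
      and "H y' = H y" "norm y' < ?N (H y) + e / 2"
      using quotient_norm_lessD[of H x "?N (H x) + e / 2"]
        quotient_norm_lessD[of H y "?N (H y) + e / 2"] \<open>0 < e\<close> by auto
    moreover from this have "H (x' + y') = H (x + y)"
      by (simp add: add)
    ultimately show "?N (H (x + y)) \<le> ?N (H x) + ?N (H y) + e"
      using quotient_norm_le[of H "x' + y'"] norm_triangle_ineq[of x' y'] by simp
  qed
  have N_scale_le: "?N (H (smul a x)) \<le> norm a * ?N (H x)" if "a \<noteq> 0" for a x
  proof -
    have "?N (H (smul a x)) / norm a \<le> ?N (H x)"
    proof (rule quotient_norm_greatest)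
      fix y
      assume "H y = H x"
      then have "H (smul a y) = H (smul a x)"
        by (simp add: scale)
      then have "?N (H (smul a x)) \<le> norm a * norm y"
        using quotient_norm_le[of H "smul a y"] by (simp add: norm_smul)
      then show "?N (H (smul a x)) / norm a \<le> norm y"
        using that by (simp add: pos_divide_le_eq mult.commute)
    qed
    then show ?thesis
      using that by (simp add: pos_divide_le_eq mult.commute)
  qed
  have N_scale: "?N (H (smul a x)) = norm a * ?N (H x)" for a x
  proof (cases "a = 0")
    case True
    then show ?thesis
      using N_zero[of 0] H_zero by simp
  next
    case False
    have "?N (H x) \<le> norm (inverse a) * ?N (H (smul a x))"
      using N_scale_le[of "inverse a" "smul a x"] False by simp
    then have "norm a * ?N (H x) \<le> norm a * (norm (inverse a) * ?N (H (smul a x)))"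
      by (rule mult_left_mono) simp
    also have "\<dots> = ?N (H (smul a x))"
      using False by (simp add: norm_inverse flip: mult.assoc)
    finally have "norm a * ?N (H x) \<le> ?N (H (smul a x))" .
    then show ?thesis
      using N_scale_le[OF False] by (simp add: antisym)
  qed
  have dist: "?d (H x) (H y) = ?N (H (x - y))" for x y
    by (simp add: norm_dist_def diff)
  interpret Metric_space "range H" ?d
  proof
    fix c e
    have "0 \<le> ?d c e \<and> ?d c e = ?d e c"
    proof (cases "c \<in> range H \<and> e \<in> range H")
      case True
      then obtain x y where "c = H x" "e = H y"
        by blast
      moreover have "?N (H (x - y)) = ?N (H (y - x))"
        using N_scale[of "-1" "x - y"] by simp
      ultimately show ?thesis
        by (simp add: dist quotient_norm_nonneg)
    qed (auto simp: norm_dist_def)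
    then show "0 \<le> ?d c e" "?d c e = ?d e c"
      by auto
  next
    fix c e
    assume "c \<in> range H" "e \<in> range H"
    then obtain x y where c: "c = H x" and e: "e = H y"
      by blast
    show "?d c e = 0 \<longleftrightarrow> c = e"
      unfolding c e dist N_zero by (simp add: diff fun_eq_iff)
  next
    fix c e f
    assume "c \<in> range H" "e \<in> range H" "f \<in> range H"
    then obtain x y z where "c = H x" "e = H y" "f = H z"
      by blast
    then show "?d c f \<le> ?d c e + ?d e f"
      using N_add[of "x - y" "y - z"] by (simp add: dist)
  qed
  have "mcomplete"
    unfolding mcomplete_def
  proof (intro allI impI)
    fix \<sigma>
    assume cauchy: "MCauchy \<sigma>"
    then have "\<exists>u. \<sigma> n = H u" for n
      unfolding MCauchy_def by (auto simp: image_subset_iff)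
    then obtain u where u: "\<And>n. \<sigma> n = H (u n)"
      by metis
    have "\<forall>k. \<exists>M. \<forall>n n'. M \<le> n \<longrightarrow> M \<le> n' \<longrightarrow> ?d (\<sigma> n) (\<sigma> n') < (1 / 2) ^ k"
      using cauchy unfolding MCauchy_def by simp
    then obtain M where
      M: "\<And>k n n'. M k \<le> n \<Longrightarrow> M k \<le> n' \<Longrightarrow> ?d (\<sigma> n) (\<sigma> n') < (1 / 2) ^ k"
      by metis
    \<comment> \<open>Any strictly increasing sequence that dominates \<open>M\<close> would do.\<close>
    define r where "r k = (\<Sum>j\<le>k. Suc (M j))" for k
    have r: "strict_mono r"
      by (rule strict_mono_Suc_iff[THEN iffD2]) (simp add: r_def)
    have M_le: "M k \<le> r k" "M k \<le> r (Suc k)" for k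
      by (cases k; simp add: r_def)+
    have "\<exists>y. H y = H (u (r (Suc k)) - u (r k)) \<and> norm y < (1 / 2) ^ k" for k
      using M[OF M_le(2,1), of k] quotient_norm_lessD[of H "u (r (Suc k)) - u (r k)"] by (simp add: u dist)
    then obtain y where y: "\<And>k. H (y k) = H (u (r (Suc k)) - u (r k))"
      and small: "\<And>k. norm (y k) < (1 / 2) ^ k"
      by metis
    have "summable y"
      by (rule summable_comparison_test'[of "\<lambda>k. (1 / 2) ^ k" 0])
        (use small in \<open>auto intro: less_imp_le\<close>)
    \<comment> \<open>The lifted differences telescope, so the partial sums of \<open>y\<close> represent the subsequence and
      the whole series represents its limit.\<close>
    define l where "l = u (r 0) + suminf y"
    have partial: "H (u (r k)) = H (u (r 0) + sum y {..<k})" for k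
    proof (induction k)
      case (Suc k)
      have "H (u (r (Suc k))) = H (u (r k) + (u (r (Suc k)) - u (r k)))"
        by simp
      also have "\<dots> = H (u (r 0) + sum y {..<k} + y k)"
        by (simp only: add[of "u (r k)"] add[of "u (r 0) + sum y {..<k}"] Suc.IH y)
      finally show ?case
        by (simp add: add.assoc)
    qed simp
    have le: "?d (\<sigma> (r k)) (H l) \<le> norm (sum y {..<k} - suminf y)" for k
    proof -
      have "?d (\<sigma> (r k)) (H l) = ?N (H (sum y {..<k} - suminf y))"
        unfolding u partial dist l_def by simp
      then show ?thesis
        by (simp add: quotient_norm_le)
    qed
    have "(\<lambda>k. norm (sum y {..<k} - suminf y)) \<longlonglongrightarrow> 0"
      using summable_LIMSEQ[OF \<open>summable y\<close>] by (simp add: LIM_zero tendsto_norm_zero)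
    then have "(\<lambda>k. ?d (\<sigma> (r k)) (H l)) \<longlonglongrightarrow> 0"
      by (rule Lim_null_comparison[rotated]) (use le in \<open>simp add: eventually_sequentially\<close>)
    then have "limitin mtopology (\<sigma> \<circ> r) (H l) sequentially"
      by (simp add: limitin_metric_dist_null u)
    then show "\<exists>c. limitin mtopology \<sigma> c sequentially"
      using MCauchy_convergent_subsequence[OF cauchy r] by blast
  qed
  moreover have "continuous_map mtopology euclidean (\<lambda>c. c n i)" for n i
  proof -
    obtain C where "C > 0" and C: "\<And>x. norm (H x n i) \<le> C * ?N (H x)"
      using coordinate by blast
    have "continuous_map mtopology Met_TC.mtopology (\<lambda>c. c n i)"
      unfolding Met_TC.continuous_map_to_metric topspace_mtopology
    proof (intro ballI allI impI)
      fix c and e :: real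
      assume "c \<in> range H" "0 < e"
      have "dist (c n i) (b n i) < e" if b: "b \<in> mball c (e / C)" for b
      proof -
        obtain x y where "c = H x" "b = H y"
          using b by (auto simp: in_mball)
        then have "norm (c n i - b n i) \<le> C * ?d c b"
          using C[of "x - y"] by (simp add: dist diff)
        also have "\<dots> < e"
          using b \<open>C > 0\<close> by (simp add: in_mball pos_less_divide_eq mult.commute)
        finally show ?thesis
          by (simp add: dist_norm)
      qed
      then show "\<exists>U. openin mtopology U \<and> c \<in> U \<and> (\<forall>b\<in>U. b n i \<in> Met_TC.mball (c n i) e)"
        using \<open>c \<in> range H\<close> \<open>0 < e\<close> \<open>C > 0\<close> by (intro exI[of _ "mball c (e / C)"]) auto
    qed
    then show ?thesis
      by simp
  qed
  moreover have "(\<lambda>n i. 0) \<in> range H"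
    unfolding H_zero[symmetric] by (rule rangeI)
  moreover have "(\<lambda>n i. H x n i + H y n i) \<in> range H" for x y
    unfolding add[symmetric] by (rule rangeI)
  moreover have "(\<lambda>n i. a * H x n i) \<in> range H" for a x
    unfolding scale[symmetric] by (rule rangeI)
  moreover have "?N (\<lambda>n i. H x n i + H y n i) \<le> ?N (H x) + ?N (H y)" for x y
    using N_add[of x y] by (simp only: add)
  moreover have "?N (\<lambda>n i. a * H x n i) = norm a * ?N (H x)" for a x
    using N_scale[of a x] by (simp only: scale)
  ultimately show ?thesis
    unfolding BK_space_def ball_simps
    by (intro conjI allI ballI families quotient_norm_nonneg N_zero)
qed

text \<open>
  Preimages of the same family under \<open>H\<close> have the same expansions, hence the same image under
  \<open>K\<close>. The bound \<open>C\<close> of \<open>K\<close> therefore applies to every preimage, and the infimum gives the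
  lower estimate.
\<close>

lemma approx_K_atomic_decomposition_quotient_norm:
  assumes K: "K \<in> bounded_operators smul"
    and dual: "\<And>n i. i \<in> {1..m n} \<Longrightarrow> h n i \<in> dual_space smul"
    and lim: "\<And>y. (\<lambda>n. \<Sum>i = 1..m n. smul (h n i y) (x i)) \<longlonglongrightarrow> K y"
  defines "H \<equiv> \<lambda>y. restrict_family m (\<lambda>n i. h n i y)"
  shows "BK_space m (range H) (quotient_norm H)"
    and "approx_K_atomic_decomposition smul K m x h (range H) (quotient_norm H)"
proof -
  have "(\<lambda>y. H y n i) \<in> dual_space smul" for n i
    by (cases "i \<in> {1..m n}") (simp_all add: H_def restrict_family_def dual dual_space_zero del: atLeastAtMost_iff)
  moreover have "range H \<subseteq> families m"
    by (auto simp: H_def restrict_family_def families_def)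
  ultimately show "BK_space m (range H) (quotient_norm H)"
    by (rule BK_space_quotient_norm)
  obtain C where C: "\<And>y. norm (K y) \<le> C * norm y"
    using K bounded_operators_iff by blast
  have K_eq: "K y = K z" if "H y = H z" for y z
  proof -
    have "h n i y = h n i z" if "i \<in> {1..m n}" for n i
      using fun_cong[OF fun_cong[OF \<open>H y = H z\<close>], of n i] that by (simp add: H_def restrict_family_def)
    then have eq: "(\<lambda>n. \<Sum>i = 1..m n. smul (h n i y) (x i)) = (\<lambda>n. \<Sum>i = 1..m n. smul (h n i z) (x i))"
      by (intro ext sum.cong) simp_all
    show ?thesis
      using lim[of y] unfolding eq by (rule LIMSEQ_unique[OF _ lim])
  qed
  \<comment> \<open>The constant is positive and at most 1, the constant of the upper estimate, for every real
    \<open>C\<close>.\<close>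
  have "1 / (\<bar>C\<bar> + 1) * norm (K y) \<le> quotient_norm H (H y)" for y
  proof (rule quotient_norm_greatest)
    fix z
    assume "H z = H y"
    then have "norm (K y) \<le> C * norm z"
      using K_eq C by metis
    also have "\<dots> \<le> (\<bar>C\<bar> + 1) * norm z"
      by (intro mult_right_mono) auto
    finally show "1 / (\<bar>C\<bar> + 1) * norm (K y) \<le> norm z"
      by (simp add: pos_divide_le_eq add_nonneg_pos mult.commute)
  qed
  moreover have "0 < 1 / (\<bar>C\<bar> + 1)" "1 / (\<bar>C\<bar> + 1) \<le> 1"
    by (simp_all add: add_nonneg_pos)
  moreover have "quotient_norm H (H y) \<le> 1 * norm y" for y
    by (simp add: quotient_norm_le)
  ultimately have "\<exists>A B. 0 < A \<and> A \<le> B \<and>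
    (\<forall>y. A * norm (K y) \<le> quotient_norm H (H y) \<and> quotient_norm H (H y) \<le> B * norm y)"
    by (intro exI[of _ "1 / (\<bar>C\<bar> + 1)"] exI[of _ 1] conjI allI)
  moreover have "restrict_family m (\<lambda>n i. h n i y) = H y" for y
    by (simp add: H_def)
  ultimately show "approx_K_atomic_decomposition smul K m x h (range H) (quotient_norm H)"
    using lim by (simp add: approx_K_atomic_decomposition_def)
qed

end

theorem theorem2p4:
  fixes smul :: "'k::real_or_complex \<Rightarrow> 'a::banach \<Rightarrow> 'a"
    and K :: "'a \<Rightarrow> 'a"
  assumes "banach_space_over smul"
    and "separable_space (euclidean :: 'a topology)"
    and "K \<in> bounded_operators smul"
    and "K \<noteq> (\<lambda>x. 0)"
    and "closed (range K)"
  shows "(\<exists>(m :: nat \<Rightarrow> nat) (x :: nat \<Rightarrow> 'a) (h :: nat \<Rightarrow> nat \<Rightarrow> 'a \<Rightarrow> 'k)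
            (X :: (nat \<Rightarrow> nat \<Rightarrow> 'k) set) (N :: (nat \<Rightarrow> nat \<Rightarrow> 'k) \<Rightarrow> real).
            strict_mono m \<and> (\<forall>n. 0 < m n) \<and>
            (\<forall>n. \<forall>i\<in>{1..m n}. h n i \<in> dual_space smul) \<and>
            BK_space m X N \<and>
            approx_K_atomic_decomposition smul K m x h X N)
     \<longleftrightarrow> (\<exists>v :: nat \<Rightarrow> 'a \<Rightarrow> 'a.
            (\<forall>i. v i \<in> bounded_operators smul \<and> finite_rank smul (v i)) \<and>
            (\<forall>x. (\<lambda>i. v i x) sums K x))"
    (is "?decomposition \<longleftrightarrow> ?series")
proof -
  interpret banach_space_over smul
    by fact
  show ?thesis
  proof
    assume ?decomposition
    then obtain m x h X N where dual: "\<And>n i. i \<in> {1..m n} \<Longrightarrow> h n i \<in> dual_space smul"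
      and "approx_K_atomic_decomposition smul K m x h X N"
      by blast
    then have "\<And>y. (\<lambda>n. \<Sum>i = 1..m n. smul (h n i y) (x i)) \<longlonglongrightarrow> K y"
      by (simp add: approx_K_atomic_decomposition_def)
    with dual show ?series
      by (rule finite_rank_series_if_finite_expansions_converge)
  next
    assume ?series
    then obtain v where v: "\<And>n. v n \<in> bounded_operators smul" "\<And>n. finite_rank smul (v n)"
      and sums: "\<And>y. (\<lambda>n. v n y) sums K y"
      by blast
    obtain m :: "nat \<Rightarrow> nat" and h x where m: "strict_mono m" "\<And>n. 0 < m n"
      and dual: "\<And>n i. i \<in> {1..m n} \<Longrightarrow> h n i \<in> dual_space smul"
      and expansion: "\<And>n y. (\<Sum>i = 1..m n. smul (h n i y) (x i)) = (\<Sum>k\<le>n. v k y)"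
      using finite_expansions_if_finite_rank_series[of v, OF v] by blast
    have lim: "(\<lambda>n. \<Sum>i = 1..m n. smul (h n i y) (x i)) \<longlonglongrightarrow> K y" for y
      using sums[of y] unfolding expansion sums_def_le .
    show ?decomposition
      by (intro exI conjI allI ballI; rule m dual
          approx_K_atomic_decomposition_quotient_norm[OF assms(3) dual lim]; assumption?)
  qed
qed

end
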